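(* Let $q$ be a prime power, $2\le n\le m$, $\mathcal{C}\subseteq\mathrm{Mat}$ a rank-metric code and $t=\mathrm{maxrk}(\mathcal{C})$. The following are equivalent: (1) $\mathcal{C}$ is an optimal anticode; (2) $\{\rho_{\mathrm c}(\mathcal{C},J)\mid J\subseteq\mathbb{F}_q^n\}=\{0,1,\dots,t\}$, or $m=n$ and $\{\rho_{\mathrm r}(\mathcal{C},J)\mid J\subseteq\mathbb{F}_q^n\}=\{0,1,\dots,t\}$; (3) $\rho_{\mathrm c}(\mathcal{C},\mathbb{F}_q^n)=t$, or $m=n$ and $\rho_{\mathrm r}(\mathcal{C},\mathbb{F}_q^n)=t$. In particular, the $q$-polymatroid associated to an optimal anticode is a $q$-matroid.
   Context: $\mathrm{Mat}$ is the $\mathbb{F}_q$-space of $n\times m$ matrices over $\mathbb{F}_q$; a rank-metric code is an $\mathbb{F}_q$-linear subspace; $\mathrm{maxrk}(\mathcal{C})=\max\{\mathrm{rk}(M)\mid M\in\mathcal{C}\}$, and $\mathcal{C}$ is an optimal anticode if $\dim\mathcal{C}=m\cdot\mathrm{maxrk}(\mathcal{C})$. For subspaces $J\subseteq\mathbb{F}_q^n$, $K\subseteq\mathbb{F}_q^m$: $\mathcal{C}(J,\mathrm c)=\{M\in\mathcal{C}\mid\mathrm{colsp}(M)\subseteq J\}$, $\mathcal{C}(K,\mathrm r)=\{M\in\mathcal{C}\mid\mathrm{rowsp}(M)\subseteq K\}$, $\rho_{\mathrm c}(\mathcal{C},J)=(\dim\mathcal{C}-\dim\mathcal{C}(J^\perp,\mathrm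 c))/m$, $\rho_{\mathrm r}(\mathcal{C},K)=(\dim\mathcal{C}-\dim\mathcal{C}(K^\perp,\mathrm r))/n$ ($\perp$ for the standard inner product). The associated $q$-polymatroids are $(\mathbb{F}_q^n,\rho_{\mathrm c}(\mathcal{C},\cdot))$ and $(\mathbb{F}_q^m,\rho_{\mathrm r}(\mathcal{C},\cdot))$. A $q$-polymatroid $(\mathbb{F}_q^N,\rho)$ is a real-valued function $\rho$ on subspaces with $0\le\rho(A)\le\dim A$, monotone, and submodular ($\rho(A+B)+\rho(A\cap B)\le\rho(A)+\rho(B)$); it is a $q$-matroid if $\rho$ is integer-valued. *)

theory Defs
  imports "HOL-Analysis.Analysis"
begin

text \<open>Matrices M :: 'a^'m^'n are n x m matrices (rows indexed by 'n, columns by 'm)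
  over the finite field 'a = F_q, with n = CARD('n), m = CARD('m).\<close>

definition mscale :: "'a::field \<Rightarrow> 'a^'m^'n \<Rightarrow> 'a^'m^'n" where
  "mscale c M = (\<chi> i j. c * M$i$j)"

interpretation mat: vector_space "mscale :: 'a::field \<Rightarrow> 'a^'m^'n \<Rightarrow> 'a^'m^'n"
  by unfold_locales (simp_all add: mscale_def vec_eq_iff algebra_simps)

definition colsp :: "'a::field^'m^'n \<Rightarrow> ('a^'n) set" where
  "colsp M = vec.span (columns M)"

definition rowsp :: "'a::field^'m^'n \<Rightarrow> ('a^'m) set" where
  "rowsp M = vec.span (rows M)"

definition perp :: "('a::field^'k) set \<Rightarrow> ('a^'k) set" where
  "perp J = {x. \<forall>y\<in>J. scalar_product x y = 0}"

definition maxrk :: "('a::field^'m^'n) set \<Rightarrow> nat" where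
  "maxrk C = Max (rank ` C)"

definition optimal_anticode :: "('a::field^'m^'n) set \<Rightarrow> bool" where
  "optimal_anticode C \<longleftrightarrow> mat.dim C = CARD('m) * maxrk C"

definition subcode_c :: "('a::field^'m^'n) set \<Rightarrow> ('a^'n) set \<Rightarrow> ('a^'m^'n) set" where
  "subcode_c C J = {M \<in> C. colsp M \<subseteq> J}"

definition subcode_r :: "('a::field^'m^'n) set \<Rightarrow> ('a^'m) set \<Rightarrow> ('a^'m^'n) set" where
  "subcode_r C K = {M \<in> C. rowsp M \<subseteq> K}"

definition rho_c :: "('a::field^'m^'n) set \<Rightarrow> ('a^'n) set \<Rightarrow> real" where
  "rho_c C J = (real (mat.dim C) - real (mat.dim (subcode_c C (perp J)))) / real CARD('m)"

definition rho_r :: "('a::field^'m^'n) set \<Rightarrow> ('a^'m) set \<Rightarrow> real" where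
  "rho_r C K = (real (mat.dim C) - real (mat.dim (subcode_r C (perp K)))) / real CARD('n)"

text \<open>q-polymatroids and q-matroids on F_q^k (rho is only relevant on subspaces).\<close>
definition q_polymatroid :: "(('a::field^'k) set \<Rightarrow> real) \<Rightarrow> bool" where
  "q_polymatroid \<rho> \<longleftrightarrow>
     (\<forall>A. vec.subspace A \<longrightarrow> 0 \<le> \<rho> A \<and> \<rho> A \<le> real (vec.dim A)) \<and>
     (\<forall>A B. vec.subspace A \<and> vec.subspace B \<and> A \<subseteq> B \<longrightarrow> \<rho> A \<le> \<rho> B) \<and>
     (\<forall>A B. vec.subspace A \<and> vec.subspace B \<longrightarrow>
        \<rho> (vec.span (A \<union> B)) + \<rho> (A \<inter> B) \<le> \<rho> A + \<rho> B)"

definition q_matroid :: "(('a::field^'k) set \<Rightarrow> real) \<Rightarrow> bool" where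
  "q_matroid \<rho> \<longleftrightarrow> q_polymatroid \<rho> \<and> (\<forall>A. vec.subspace A \<longrightarrow> \<rho> A \<in> \<int>)"

end

theory Submission
  imports Defs
begin

text \<open>
  Everything rests on Meshulam's description of the optimal anticodes: C consists of all matrices
  whose column space lies in some U, or m = n and the same holds for row spaces.
  Let P i be the space of i-th rows of those code words whose earlier rows vanish. The dimensions
  of the P i add up to at least dim C = m t. Linearly independent vectors chosen from s of the P i
  yield a code word of rank at least s, so s \<le> t. By a greedy choice this forces either at most t
  of the P i to be nonzero, or m = n and all P i to be the same space of dimension t. In both cases
  C projects bijectively onto t rows (or, after transposing, t columns), and the bound on the rank
  makes the remaining rows fixed linear combinations of these.

  For such a C we have \<rho>(J) = dim U - dim (U \<inter> perp J), which is an integer-valued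
  rank function taking every value up to dim U = t.
\<close>

subsection \<open>Counting and rank\<close>

text \<open>Coordinates with respect to a basis. The locale makes this available for vectors and for
  matrices, where dimensions are compared by counting elements.\<close>

lemma (in vector_space) card_subspace_eq_power_dim:
  assumes "finite (UNIV :: 'a set)" "finite S" "subspace S"
  shows "card S = CARD('a) ^ dim S"
proof -
  obtain B where B: "B \<subseteq> S" "independent B" "S \<subseteq> span B" "card B = dim S"
    by (rule basis_exists)
  have fin: "finite B"
    using B(1) assms(2) by (rule finite_subset)
  have S: "span B = S"
    using B assms(3) by (intro span_subspace)
  define f where "f = (\<lambda>u. \<Sum>b\<in>B. scale (u b) b)"
  have "inj_on f (B \<rightarrow>\<^sub>E UNIV)"
  proof (rule inj_onI)
    fix u v assume uv: "u \<in> B \<rightarrow>\<^sub>E UNIV" "v \<in> B \<rightarrow>\<^sub>E UNIV" "f u = f v"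
    then have "(\<Sum>b\<in>B. scale (u b - v b) b) = 0"
      by (simp add: f_def scale_left_diff_distrib sum_subtractf)
    then have "u b = v b" if "b \<in> B" for b
      using independentD[OF B(2) fin order_refl _ that, of "\<lambda>b. u b - v b"] by simp
    with uv(1,2) show "u = v" by (rule PiE_ext)
  qed
  moreover have "f ` (B \<rightarrow>\<^sub>E UNIV) = span B"
  proof -
    have "f u \<in> f ` (B \<rightarrow>\<^sub>E UNIV)" for u
      by (rule image_eqI[of _ _ "restrict u B"]) (simp_all add: f_def)
    then have "f ` (B \<rightarrow>\<^sub>E UNIV) = range f"
      by blast
    then show ?thesis
      by (simp add: span_finite[OF fin] f_def)
  qed
  ultimately have "card S = card (B \<rightarrow>\<^sub>E (UNIV :: 'a set))"
    using S card_image by metis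
  then show ?thesis
    using B(4) by (simp add: card_PiE[OF fin])
qed

text \<open>An element is determined by its image and by its difference from a chosen preimage of
  that image; the difference lies in the kernel.\<close>

lemma card_additive_subgroup_le:
  fixes f :: "'b::ab_group_add \<Rightarrow> 'c::ab_group_add"
  assumes "finite G" and diff: "\<And>x y. x \<in> G \<Longrightarrow> y \<in> G \<Longrightarrow> x - y \<in> G"
    and f: "\<And>x y. f (x - y) = f x - f y"
  shows "card G \<le> card (f ` G) * card {x \<in> G. f x = 0}"
proof -
  define s where "s = inv_into G f"
  have s: "s (f x) \<in> G" "f (s (f x)) = f x" if "x \<in> G" for x
    using that by (auto simp: s_def inv_into_into f_inv_into_f)
  have "inj_on (\<lambda>x. (f x, x - s (f x))) G"
    by (rule inj_onI) auto
  moreover have "(\<lambda>x. (f x, x - s (f x))) ` G \<subseteq> f ` G \<times> {x \<in> G. f x = 0}"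
    using s diff f by auto
  ultimately have "card G \<le> card (f ` G \<times> {x \<in> G. f x = 0})"
    using assms(1) by (intro card_inj_on_le) auto
  then show ?thesis by (simp add: card_cartesian_product)
qed

lemma vec_card_subspace:
  fixes S :: "('a::{field,finite}^'k) set"
  assumes "vec.subspace S"
  shows "card S = CARD('a) ^ vec.dim S"
  using assms by (intro vec.card_subspace_eq_power_dim) auto

lemma mat_card_subspace:
  fixes S :: "('a::{field,finite}^'m^'n) set"
  assumes "mat.subspace S"
  shows "card S = CARD('a) ^ mat.dim S"
  using assms by (intro mat.card_subspace_eq_power_dim) auto

lemma field_card_gt_1: "CARD('a::{field,finite}) > 1"
proof -
  have "card {0, 1 :: 'a} \<le> CARD('a)" by (intro card_mono) auto
  then show ?thesis by simp
qed

section \<open>Rows, columns and rank\<close>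

lemma rows_eq_range: "rows M = range (\<lambda>i. M $ i)"
  by (auto simp: rows_def row_def)

lemma columns_eq_range: "columns M = range (\<lambda>j. column j M)"
  by (auto simp: columns_def)

lemma dim_rows_le_rank: "vec.dim ((\<lambda>i. M $ i) ` I) \<le> rank M"
  unfolding row_rank_def_gen rows_eq_range by (intro vec.dim_subset) auto

text \<open>Expand the rows in a basis of the row space: the coefficient vectors, one per basis
  element, span all columns.\<close>

lemma rank_transpose_le:
  fixes M :: "'a::field^'m^'n"
  shows "rank (transpose M) \<le> rank M"
proof -
  obtain B where B: "B \<subseteq> rows M" "vec.independent B" "rows M \<subseteq> vec.span B" "card B = vec.dim (rows M)"
    by (rule vec.basis_exists)
  have fin: "finite B" using B(1) by (rule finite_subset) (simp add: rows_eq_range)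
  have "\<exists>u. M $ i = (\<Sum>b\<in>B. u b *s b)" for i
    using B(3) vec.span_finite[OF fin] by (auto simp: rows_eq_range)
  then obtain u where u: "M $ i = (\<Sum>b\<in>B. u i b *s b)" for i
    by metis
  have "column j M = (\<Sum>b\<in>B. b $ j *s (\<chi> i. u i b))" for j
    by (simp add: vec_eq_iff column_def u mult.commute)
  then have "columns M \<subseteq> vec.span ((\<lambda>b. \<chi> i. u i b) ` B)"
    by (auto simp: columns_eq_range intro!: vec.span_sum vec.span_scale intro: vec.span_base)
  then have "vec.dim (columns M) \<le> card ((\<lambda>b. \<chi> i. u i b) ` B)"
    using fin by (intro vec.dim_le_card) auto
  also have "\<dots> \<le> card B" by (rule card_image_le[OF fin])
  finally show ?thesis using B(4) by (simp add: row_rank_def_gen)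
qed

text \<open>Each vector adds at most one dimension. The reverse inequality therefore says that the
  family \<open>p\<close> is linearly independent modulo \<open>W\<close>; the lemmas below express
  independence in this form.\<close>

lemma dim_Un_image_le:
  fixes p :: "'i \<Rightarrow> 'a::field^'m"
  assumes "finite I"
  shows "vec.dim (W \<union> p ` I) \<le> vec.dim W + card I"
  using assms by (induction I) (auto simp: vec.dim_insert)

text \<open>The rows are treated from the last one backwards: adding the code word that leads with p i
  changes row i modulo the rest without touching the earlier rows, so one of the two choices
  (add it or not) is good. This avoids genericity arguments and works over the field with two
  elements.\<close>

lemma exists_independent_rows:
  fixes C :: "('a::field^'m^'n) set" and e :: "'n \<Rightarrow> nat"
  assumes C: "mat.subspace C" and "inj e"
    and lead: "\<And>i. i \<in> I \<Longrightarrow> \<exists>M\<in>C. M $ i = p i \<and> (\<forall>k. e k < e i \<longrightarrow> M $ k = 0)"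
    and "vec.dim W + card I \<le> vec.dim (W \<union> p ` I)"
  shows "\<exists>M\<in>C. vec.dim W + card I \<le> vec.dim (W \<union> (\<lambda>i. M $ i) ` I)"
  using finite[of I] lead assms(4)
proof (induction "card I" arbitrary: I W)
  case 0
  then show ?case using mat.subspace_0[OF C] by auto
next
  case (Suc n)
  have "I \<noteq> {}" using Suc.hyps(2) by auto
  then have "Max (e ` I) \<in> e ` I"
    using Suc.prems(1) by (intro Max_in) auto
  then obtain r where "r \<in> I" "e r = Max (e ` I)"
    by auto
  then have r: "r \<in> I" "\<And>i. i \<in> I \<Longrightarrow> e i \<le> e r"
    using Suc.prems(1) by auto
  define J where "J = I - {r}"
  have J: "I = insert r J" "r \<notin> J" "card J = n" "finite J"
    using r(1) Suc.hyps(2) Suc.prems(1) by (auto simp: J_def)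
  have lt: "e i < e r" if "i \<in> J" for i
    using r(2)[of i] that J(1,2) \<open>inj e\<close> by (metis inj_eq insertCI order_le_less)
  have "vec.dim (insert (p r) W \<union> p ` J) \<le> vec.dim (insert (p r) W) + card J"
    by (rule dim_Un_image_le[OF J(4)])
  \<comment> \<open>The rows in \<open>J\<close> add at most \<open>card J\<close> dimensions, so
    \<open>p r\<close> must add one itself.\<close>
  then have W: "vec.dim (insert (p r) W) = vec.dim W + 1"
    and *: "vec.dim (insert (p r) W) + card J \<le> vec.dim (insert (p r) W \<union> p ` J)"
    using Suc.prems(3) J by (auto simp: vec.dim_insert split: if_splits)
  \<comment> \<open>With \<open>p r\<close> moved into \<open>W\<close>, the rows of
    \<open>M\<close> in \<open>J\<close> are independent even modulo \<open>p r\<close>. Hence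
    \<open>p r\<close> is outside the span of \<open>W\<close> and these rows.\<close>
  obtain M where M: "M \<in> C"
    "vec.dim (insert (p r) W) + card J \<le> vec.dim (insert (p r) W \<union> (\<lambda>i. M $ i) ` J)"
    using Suc.hyps(1)[of J "insert (p r) W"] J Suc.prems(2) * by auto
  obtain B where B: "B \<in> C" "B $ r = p r" "\<And>k. e k < e r \<Longrightarrow> B $ k = 0"
    using Suc.prems(2)[OF r(1)] by auto
  define X where "X = W \<union> (\<lambda>i. M $ i) ` J"
  have "vec.dim X \<le> vec.dim W + card J"
    unfolding X_def by (rule dim_Un_image_le[OF J(4)])
  moreover have "vec.dim W + 1 + card J \<le> vec.dim (insert (p r) X)"
    using M(2) W by (simp add: X_def)
  ultimately have X: "vec.dim X = vec.dim W + card J" "p r \<notin> vec.span X"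
    by (auto simp: vec.dim_insert split: if_splits)
  have I: "vec.dim W + card I \<le> vec.dim (W \<union> (\<lambda>i. N $ i) ` I)"
    if "\<And>i. i \<in> J \<Longrightarrow> N $ i = M $ i" "N $ r \<notin> vec.span X" for N
  proof -
    have "(\<lambda>i. N $ i) ` I = insert (N $ r) ((\<lambda>i. M $ i) ` J)"
      using that J by force
    then have "W \<union> (\<lambda>i. N $ i) ` I = insert (N $ r) X" by (simp add: X_def)
    then show ?thesis using that(2) X J by (simp add: vec.dim_insert)
  qed
  show ?case
  proof (cases "M $ r \<in> vec.span X")
    case False
    with I[of M] M(1) show ?thesis by blast
  next
    case True
    then have "(M + B) $ r \<notin> vec.span X"
      using X(2) B(2) vec.span_add_eq by auto
    with I[of "M + B"] B lt have "vec.dim W + card I \<le> vec.dim (W \<union> (\<lambda>i. (M + B) $ i) ` I)"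
      by simp
    then show ?thesis using mat.subspace_add[OF C M(1) B(1)] by blast
  qed
qed

text \<open>Greedy choice: \<open>W\<close> and the vectors chosen so far span a space of dimension
  smaller than that of the next \<open>P i\<close>.\<close>

lemma exists_independent_choice:
  fixes P :: "'i \<Rightarrow> ('a::field^'m) set"
  assumes "finite J" "\<And>i. i \<in> J \<Longrightarrow> vec.dim W + card J \<le> vec.dim (P i)"
  shows "\<exists>x. (\<forall>i\<in>J. x i \<in> P i) \<and> vec.dim W + card J \<le> vec.dim (W \<union> x ` J)"
  using assms
proof (induction J)
  case empty
  then show ?case by simp
next
  case (insert r J)
  then obtain x where x: "\<forall>i\<in>J. x i \<in> P i" "vec.dim W + card J \<le> vec.dim (W \<union> x ` J)"
    by force
  have "vec.dim (W \<union> x ` J) \<le> vec.dim W + card J"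
    by (rule dim_Un_image_le[OF insert.hyps(1)])
  then have "vec.dim (W \<union> x ` J) < vec.dim (P r)"
    using insert.prems[of r] insert.hyps by simp
  then have "\<not> P r \<subseteq> vec.span (W \<union> x ` J)"
    using vec.dim_subset[of "P r" "vec.span (W \<union> x ` J)"] by auto
  then obtain v where v: "v \<in> P r" "v \<notin> vec.span (W \<union> x ` J)" by blast
  have "(x(r := v)) ` insert r J = insert v (x ` J)"
    using insert.hyps by auto
  then have "vec.dim W + card (insert r J) \<le> vec.dim (W \<union> (x(r := v)) ` insert r J)"
    using v(2) x(2) insert.hyps by (simp add: vec.dim_insert)
  then show ?case using v(1) x(1) insert.hyps by (intro exI[of _ "x(r := v)"]) auto
qed

subsection \<open>Spaces of leading rows\<close>

text \<open>The index type carries no order, so \<open>e\<close> supplies one. For injective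
  \<open>e\<close> these are the successive quotients of the filtration of \<open>C\<close> by
  vanishing initial rows.\<close>

definition leading :: "('n \<Rightarrow> nat) \<Rightarrow> ('a::field^'m^'n) set \<Rightarrow> 'n \<Rightarrow> ('a^'m) set" where
  "leading e C i = (\<lambda>M. M $ i) ` {M \<in> C. \<forall>k. e k < e i \<longrightarrow> M $ k = 0}"

lemma mscale_row [simp]: "mscale c M $ i = c *s M $ i"
  by (simp add: mscale_def vec_eq_iff)

lemma subspace_leading:
  assumes C: "mat.subspace C"
  shows "vec.subspace (leading e C i)"
proof (rule vec.subspaceI)
  show "0 \<in> leading e C i"
    unfolding leading_def using mat.subspace_0[OF C] by (intro image_eqI[of _ _ 0]) auto
next
  fix x y assume "x \<in> leading e C i" "y \<in> leading e C i"
  then obtain M N where "M \<in> C" "N \<in> C" "x = M $ i" "y = N $ i"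
    "\<forall>k. e k < e i \<longrightarrow> M $ k = 0" "\<forall>k. e k < e i \<longrightarrow> N $ k = 0"
    by (auto simp: leading_def)
  then show "x + y \<in> leading e C i"
    unfolding leading_def using mat.subspace_add[OF C, of M N] by (intro image_eqI[of _ _ "M + N"]) auto
next
  fix c x assume "x \<in> leading e C i"
  then obtain M where "M \<in> C" "x = M $ i" "\<forall>k. e k < e i \<longrightarrow> M $ k = 0"
    by (auto simp: leading_def)
  then show "c *s x \<in> leading e C i"
    unfolding leading_def using mat.subspace_scale[OF C, of M c] by (intro image_eqI[of _ _ "mscale c M"]) auto
qed

text \<open>Read the rows in the order \<open>e\<close>. Words vanishing on the rows read so far map
  to the leading space of the next row, with kernel the words vanishing there as well. So
  \<open>card C\<close> is at most the product of the cardinalities, and exponents can be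
  compared.\<close>

lemma dim_le_sum_dim_leading:
  fixes C :: "('a::{field,finite}^'m^'n) set"
  assumes C: "mat.subspace C"
  shows "mat.dim C \<le> (\<Sum>i\<in>UNIV. vec.dim (leading e C i))"
proof -
  \<comment> \<open>\<open>K\<close> is the set of rows already read; it contains every row
    preceding one of its members.\<close>
  have "card {M \<in> C. \<forall>k\<in>K. M $ k = 0} \<le> (\<Prod>i\<in>-K. card (leading e C i))"
    if "\<And>i k. i \<in> K \<Longrightarrow> e k < e i \<Longrightarrow> k \<in> K" for K
    using that
  proof (induction "card (-K)" arbitrary: K)
    case 0
    then have "K = UNIV" by auto
    then have "{M \<in> C. \<forall>k\<in>K. M $ k = 0} \<subseteq> {0}" by (auto simp: vec_eq_iff)
    then have "card {M \<in> C. \<forall>k\<in>K. M $ k = 0} \<le> card {0 :: 'a^'m^'n}"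
      by (intro card_mono) auto
    then show ?case using \<open>K = UNIV\<close> by simp
  next
    case (Suc n)
    then have "- K \<noteq> {}" by auto
    then have "Min (e ` (-K)) \<in> e ` (-K)"
      by (intro Min_in) auto
    then obtain r where r_Min: "r \<in> -K" "e r = Min (e ` (-K))"
      by auto
    have r: "r \<notin> K" "\<And>k. e k < e r \<Longrightarrow> k \<in> K"
    proof -
      show "r \<notin> K" using r_Min(1) by simp
      fix k assume k: "e k < e r"
      show "k \<in> K"
      proof (rule ccontr)
        assume "k \<notin> K"
        then have "e r \<le> e k" unfolding r_Min(2) by (intro Min_le) auto
        with k show False by simp
      qed
    qed
    have K: "-K = insert r (- insert r K)" using r(1) by auto
    have "card (- insert r K) = n"
      using Suc.hyps(2) by (simp add: K)
    then have IH: "card {M \<in> C. \<forall>k\<in>insert r K. M $ k = 0} \<le> (\<Prod>i\<in>- insert r K. card (leading e C i))"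
      using Suc.prems r(2) by (intro Suc.hyps(1)) auto
    let ?G = "{M \<in> C. \<forall>k\<in>K. M $ k = 0}"
    have "card ?G \<le> card ((\<lambda>M. M $ r) ` ?G) * card {M \<in> ?G. M $ r = 0}"
      by (rule card_additive_subgroup_le) (auto intro: mat.subspace_diff[OF C])
    also have "card ((\<lambda>M. M $ r) ` ?G) \<le> card (leading e C r)"
      unfolding leading_def using r(2) by (intro card_mono image_mono) auto
    also have "{M \<in> ?G. M $ r = 0} = {M \<in> C. \<forall>k\<in>insert r K. M $ k = 0}"
      by auto
    also note IH
    finally have "card ?G \<le> card (leading e C r) * (\<Prod>i\<in>- insert r K. card (leading e C i))"
      by simp
    also have "\<dots> = (\<Prod>i\<in>-K. card (leading e C i))"
      by (subst K) simp
    finally show ?case .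
  qed
  from this[of "{}"] have "card C \<le> (\<Prod>i\<in>UNIV. card (leading e C i))" by simp
  then have "CARD('a) ^ mat.dim C \<le> CARD('a) ^ (\<Sum>i\<in>UNIV. vec.dim (leading e C i))"
    using C by (simp add: mat_card_subspace vec_card_subspace subspace_leading power_sum)
  then show ?thesis
    using power_le_imp_le_exp[OF field_card_gt_1] by blast
qed

text \<open>Greedy choice in the order of increasing dimension of the subspaces.\<close>

lemma exists_independent_transversal:
  fixes P :: "'n::finite \<Rightarrow> ('a::field^'m) set"
  assumes "\<And>d. vec.dim W \<le> d \<Longrightarrow> d < vec.dim W + s \<Longrightarrow>
             vec.dim W + s - d \<le> card {i \<in> X. d < vec.dim (P i)}"
  shows "\<exists>I p. I \<subseteq> X \<and> card I = s \<and> (\<forall>i\<in>I. p i \<in> P i) \<and> vec.dim W + s \<le> vec.dim (W \<union> p ` I)"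
  using assms
proof (induction s arbitrary: W X)
  case 0
  then show ?case by (intro exI[of _ "{}"]) auto
next
  case (Suc s)
  define Y where "Y = {i \<in> X. vec.dim W < vec.dim (P i)}"
  have Y: "Suc s \<le> card Y"
    using Suc.prems[of "vec.dim W"] by (simp add: Y_def)
  then have "Y \<noteq> {}" by auto
  then have "Min ((\<lambda>i. vec.dim (P i)) ` Y) \<in> (\<lambda>i. vec.dim (P i)) ` Y"
    by (intro Min_in) auto
  then obtain r where "r \<in> Y" "vec.dim (P r) = Min ((\<lambda>i. vec.dim (P i)) ` Y)"
    by auto
  then have r: "r \<in> Y" "\<And>i. i \<in> Y \<Longrightarrow> vec.dim (P r) \<le> vec.dim (P i)"
    by auto
  have "\<not> P r \<subseteq> vec.span W"
    using r(1) vec.dim_subset[of "P r" "vec.span W"] by (auto simp: Y_def)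
  then obtain v where v: "v \<in> P r" "v \<notin> vec.span W" by blast
  have W: "vec.dim (insert v W) = Suc (vec.dim W)"
    using v(2) by (simp add: vec.dim_insert)
  have "\<exists>I p. I \<subseteq> X - {r} \<and> card I = s \<and> (\<forall>i\<in>I. p i \<in> P i) \<and>
          vec.dim (insert v W) + s \<le> vec.dim (insert v W \<union> p ` I)"
  proof (rule Suc.IH)
    fix d assume d: "vec.dim (insert v W) \<le> d" "d < vec.dim (insert v W) + s"
    show "vec.dim (insert v W) + s - d \<le> card {i \<in> X - {r}. d < vec.dim (P i)}"
    \<comment> \<open>Below the smallest dimension in \<open>Y\<close>, all of \<open>Y\<close>
      except \<open>r\<close> is counted. Otherwise \<open>r\<close> was not counted before either,
      and the old bound persists because \<open>vec.dim (insert v W) + s\<close> equals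
      \<open>vec.dim W + Suc s\<close>.\<close>
    proof (cases "d < vec.dim (P r)")
      case True
      then have "{i \<in> X - {r}. d < vec.dim (P i)} = Y - {r}"
        using d W r(2) by (force simp: Y_def)
      then show ?thesis using Y r(1) d W by simp
    next
      case False
      then have "{i \<in> X - {r}. d < vec.dim (P i)} = {i \<in> X. d < vec.dim (P i)}" by auto
      then show ?thesis using Suc.prems[of d] d W by simp
    qed
  qed
  then obtain I p where I: "I \<subseteq> X - {r}" "card I = s" "\<forall>i\<in>I. p i \<in> P i"
    "vec.dim (insert v W) + s \<le> vec.dim (insert v W \<union> p ` I)"
    by blast
  have "(p(r := v)) ` insert r I = insert v (p ` I)" using I(1) by auto
  then have "vec.dim W + Suc s \<le> vec.dim (W \<union> (p(r := v)) ` insert r I)"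
    using I(4) W by simp
  moreover have "card (insert r I) = Suc s" using I(1,2) finite[of I] by (subst card_insert_disjoint) auto
  ultimately show ?case
    using I v(1) r(1) by (intro exI[of _ "insert r I"] exI[of _ "p(r := v)"]) (auto simp: Y_def)
qed

text \<open>The greedy choice must fail for \<open>Suc t\<close> vectors, so for some
  \<open>d \<le> t\<close> at most \<open>t - d\<close> spaces have dimension above
  \<open>d\<close>. The given sum then forces \<open>d = 0\<close>, the case \<open>rows\<close>, or
  \<open>d = t\<close>, the case \<open>same\<close>.\<close>

lemma subspaces_without_large_transversal:
  fixes P :: "'n::finite \<Rightarrow> ('a::field^'m) set"
  assumes sub: "\<And>i. vec.subspace (P i)"
    and le: "\<And>I p. (\<And>i. i \<in> I \<Longrightarrow> p i \<in> P i) \<Longrightarrow> card I \<le> vec.dim (p ` I) \<Longrightarrow> card I \<le> t"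
    and nm: "CARD('n) \<le> CARD('m)"
    and sum: "t * CARD('m) \<le> (\<Sum>i\<in>UNIV. vec.dim (P i))"
  obtains (rows) I where "card I \<le> t" "\<And>i. i \<notin> I \<Longrightarrow> P i = {0}"
  | (same) W where "CARD('n) = CARD('m)" "vec.dim W = t" "\<And>i. P i = W"
proof -
  let ?m = "CARD('m)" and ?n = "CARD('n)"
  \<comment> \<open>The negation is the hypothesis of the greedy choice for \<open>Suc t\<close>
    vectors and empty \<open>W\<close>.\<close>
  have "\<exists>d\<le>t. card {i. d < vec.dim (P i)} \<le> t - d"
  proof (rule ccontr)
    assume "\<not> ?thesis"
    then have *: "t - d < card {i. d < vec.dim (P i)}" if "d \<le> t" for d
      using that by (meson not_le)
    have "Suc t - d \<le> card {i. d < vec.dim (P i)}" if "d < Suc t" for d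
      using *[of d] that by simp
    then have "\<exists>I p. I \<subseteq> UNIV \<and> card I = Suc t \<and> (\<forall>i\<in>I. p i \<in> P i) \<and>
             vec.dim ({} :: ('a^'m) set) + Suc t \<le> vec.dim ({} \<union> p ` I)"
      by (intro exists_independent_transversal) simp
    then obtain I p where "card I = Suc t" "\<forall>i\<in>I. p i \<in> P i" "Suc t \<le> vec.dim (p ` I)"
      by auto
    then show False using le[of I p] by auto
  qed
  then obtain d where d: "d \<le> t" "card {i. d < vec.dim (P i)} \<le> t - d" by blast
  have dim_le: "vec.dim (P i) \<le> ?m" for i
    by (rule dim_subset_UNIV_cart_gen)
  then have "(\<Sum>i\<in>UNIV. vec.dim (P i)) \<le> ?n * ?m"
    using sum_bounded_above[of UNIV "\<lambda>i. vec.dim (P i)" ?m] by simp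
  with sum have "t * ?m \<le> ?n * ?m" by (rule order_trans)
  then have "t \<le> ?n" by (subst (asm) mult_le_cancel2) simp
  with nm have tm: "t \<le> ?m" by simp
  show thesis
  proof (cases "d = 0")
    case True
    have "card {i. 0 < vec.dim (P i)} \<le> t" using d True by simp
    moreover have "P i = {0}" if "i \<notin> {i. 0 < vec.dim (P i)}" for i
      using that vec.subspace_0[OF sub[of i]] by auto
    ultimately show thesis by (rule rows)
  next
    case False
    \<comment> \<open>Spaces above dimension \<open>d\<close> are bounded by \<open>?m\<close>, the
      others by \<open>d\<close>. The total bound falls short of \<open>t * ?m\<close> by
      \<open>(t - d) * d\<close>, so this product vanishes.\<close>
    have "vec.dim (P i) \<le> d + (if d < vec.dim (P i) then ?m - d else 0)" for i
      using dim_le[of i] by auto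
    then have "(\<Sum>i\<in>UNIV. vec.dim (P i)) \<le> (\<Sum>i\<in>UNIV. d + (if d < vec.dim (P i) then ?m - d else 0))"
      by (rule sum_mono)
    also have "\<dots> = ?n * d + card {i. d < vec.dim (P i)} * (?m - d)"
      by (simp add: sum.distrib sum.If_cases)
    also have "\<dots> \<le> ?m * d + (t - d) * (?m - d)"
      using nm d(2) by (intro add_mono mult_right_mono) auto
    finally have "t * ?m \<le> ?m * d + (t - d) * (?m - d)" using sum by simp
    moreover have "t * ?m = ?m * d + (t - d) * (?m - d) + (t - d) * d"
    proof -
      obtain a b where "t = d + a" "?m = d + b" using d(1) tm by (metis le_Suc_ex order_trans)
      then show ?thesis by (simp add: algebra_simps)
    qed
    ultimately have "(t - d) * d = 0" by linarith
    with False d(1) have "d = t" by simp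
    with d(2) have le_t: "vec.dim (P i) \<le> t" for i
      by (simp add: not_less[symmetric])
    have "0 < t" using False \<open>d = t\<close> by simp
    have sum_le: "(\<Sum>i\<in>UNIV. vec.dim (P i)) \<le> ?n * t"
      using sum_bounded_above[of UNIV "\<lambda>i. vec.dim (P i)" t] le_t by simp
    with sum have "t * ?m \<le> ?n * t" by (rule order_trans)
    with \<open>0 < t\<close> have "?m \<le> ?n" by (simp add: mult.commute[of t])
    with nm have n: "?n = ?m" by simp
    have dim: "vec.dim (P i) = t" for i
    proof (rule ccontr)
      assume "vec.dim (P i) \<noteq> t"
      then have "(\<Sum>i\<in>UNIV. vec.dim (P i)) < (\<Sum>i\<in>(UNIV::'n set). t)"
        using le_t by (intro sum_strict_mono_ex1) (auto intro!: exI[of _ i] simp: order_less_le)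
      with sum n show False by (simp add: mult.commute)
    qed
    \<comment> \<open>Two different spaces would give \<open>Suc t\<close> independent vectors:
      \<open>v\<close> in \<open>P a\<close> outside \<open>P b\<close>, \<open>t - 1\<close> from
      other spaces, and finally \<open>w\<close> in \<open>P b\<close>.\<close>
    have same: "P a = P b" for a b
    proof (rule ccontr)
      assume ab: "P a \<noteq> P b"
      then have "\<not> P a \<subseteq> P b"
        using vec.subspace_dim_equal[OF sub sub, of a b] dim by auto
      then obtain v where v: "v \<in> P a" "v \<notin> P b" by blast
      then have "v \<noteq> 0" using vec.subspace_0[OF sub] by auto
      \<comment> \<open>Since \<open>t < ?m\<close> and \<open>?n = ?m\<close>, at least
        \<open>t - 1\<close> indices remain besides \<open>a\<close> and \<open>b\<close>.\<close>
      have "t < ?m"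
      proof (rule ccontr)
        assume "\<not> t < ?m"
        then have "P b = UNIV"
          using vec.subspace_dim_equal[OF sub[of b] vec.subspace_UNIV] dim tm by (simp add: vec_dim_card del: vec.dim_UNIV)
        with v show False by simp
      qed
      have "a \<noteq> b" using ab by auto
      then have "t - 1 \<le> card (UNIV - {a, b})"
        using \<open>t < ?m\<close> n by (subst card_Diff_subset) auto
      then obtain J where J: "J \<subseteq> UNIV - {a, b}" "card J = t - 1"
        by (meson obtain_subset_with_card_n)
      have v1: "vec.dim {v} = 1" using \<open>v \<noteq> 0\<close> by (simp add: vec.dim_insert)
      have "\<exists>x. (\<forall>i\<in>J. x i \<in> P i) \<and> vec.dim {v} + card J \<le> vec.dim ({v} \<union> x ` J)"
        using J \<open>0 < t\<close> dim v1 by (intro exists_independent_choice) auto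
      then obtain x where x: "\<forall>i\<in>J. x i \<in> P i" "t \<le> vec.dim (insert v (x ` J))"
        using J v1 \<open>0 < t\<close> by auto
      have "\<not> P b \<subseteq> vec.span (insert v (x ` J))"
      proof
        assume "P b \<subseteq> vec.span (insert v (x ` J))"
        moreover have "vec.dim (vec.span (insert v (x ` J))) \<le> vec.dim (P b)"
          using dim_Un_image_le[OF finite[of J], of "{v}" x] v1 J dim \<open>0 < t\<close> by simp
        ultimately have "P b = vec.span (insert v (x ` J))"
          by (intro vec.subspace_dim_equal sub) auto
        then show False using v(2) vec.span_base[of v "insert v (x ` J)"] by simp
      qed
      then obtain w where w: "w \<in> P b" "w \<notin> vec.span (insert v (x ` J))" by blast
      define p where "p = x(a := v, b := w)"
      have p: "p ` insert b (insert a J) = insert w (insert v (x ` J))"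
        using J \<open>a \<noteq> b\<close> by (auto simp: p_def)
      have c: "card (insert b (insert a J)) = Suc t"
        using J \<open>a \<noteq> b\<close> \<open>0 < t\<close> finite[of J]
        by (subst card_insert_disjoint, auto)+
      have "card (insert b (insert a J)) \<le> t"
      proof (rule le)
        show "p i \<in> P i" if "i \<in> insert b (insert a J)" for i
          using that x(1) v(1) w(1) by (auto simp: p_def)
        show "card (insert b (insert a J)) \<le> vec.dim (p ` insert b (insert a J))"
          unfolding p c using w(2) x(2) by (simp add: vec.dim_insert)
      qed
      with c show False by simp
    qed
    show thesis
      by (rule that(2)[OF n dim same])
  qed
qed

subsection \<open>Codes of bounded rank and maximal dimension\<close>

lemma colsp_subset_iff:
  assumes "vec.subspace U"
  shows "colsp M \<subseteq> U \<longleftrightarrow> (\<forall>j. column j M \<in> U)"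
  unfolding colsp_def columns_eq_range
proof
  assume "vec.span (range (\<lambda>j. column j M)) \<subseteq> U"
  then show "\<forall>j. column j M \<in> U" by (auto intro: vec.span_base)
next
  assume "\<forall>j. column j M \<in> U"
  then show "vec.span (range (\<lambda>j. column j M)) \<subseteq> U"
    using assms by (intro vec.span_minimal) auto
qed

lemma rowsp_subset_iff:
  assumes "vec.subspace U"
  shows "rowsp M \<subseteq> U \<longleftrightarrow> (\<forall>i. M $ i \<in> U)"
  unfolding rowsp_def rows_eq_range
proof
  assume "vec.span (range (\<lambda>i. M $ i)) \<subseteq> U"
  then show "\<forall>i. M $ i \<in> U" by (auto intro: vec.span_base)
next
  assume "\<forall>i. M $ i \<in> U"
  then show "vec.span (range (\<lambda>i. M $ i)) \<subseteq> U"
    using assms by (intro vec.span_minimal) auto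
qed

lemma rowsp_transpose: "rowsp (transpose M) = colsp M"
  by (simp add: rowsp_def colsp_def)

lemma colsp_transpose: "colsp (transpose M) = rowsp M"
  by (simp add: rowsp_def colsp_def)

lemma subspace_rowsp:
  assumes "vec.subspace U"
  shows "mat.subspace {M. rowsp M \<subseteq> U}"
  using assms by (auto simp: rowsp_subset_iff intro!: mat.subspaceI
      vec.subspace_0 vec.subspace_add vec.subspace_scale)

lemma subspace_transpose:
  assumes "mat.subspace C"
  shows "mat.subspace (transpose ` C)"
proof (rule mat.subspaceI)
  have "transpose 0 = 0" by (simp add: transpose_def vec_eq_iff)
  then show "0 \<in> transpose ` C"
    using mat.subspace_0[OF assms] by (metis imageI)
next
  fix x y assume "x \<in> transpose ` C" "y \<in> transpose ` C"
  then obtain M N where "M \<in> C" "N \<in> C" "x = transpose M" "y = transpose N" by blast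
  moreover have "transpose M + transpose N = transpose (M + N)"
    by (simp add: transpose_def vec_eq_iff)
  ultimately show "x + y \<in> transpose ` C"
    using mat.subspace_add[OF assms] by auto
next
  fix c x assume "x \<in> transpose ` C"
  then obtain M where "M \<in> C" "x = transpose M" by blast
  moreover have "mscale c (transpose M) = transpose (mscale c M)"
    by (simp add: mscale_def transpose_def vec_eq_iff)
  ultimately show "mscale c x \<in> transpose ` C"
    using mat.subspace_scale[OF assms] by auto
qed

lemma inj_transpose: "inj transpose"
  by (rule injI, drule arg_cong[of _ _ transpose]) simp

lemma dim_transpose:
  fixes C :: "('a::{field,finite}^'m^'n) set"
  assumes "mat.subspace C"
  shows "mat.dim (transpose ` C) = mat.dim C"
proof -
  have "card (transpose ` C) = card C"
    by (intro card_image inj_on_subset[OF inj_transpose]) auto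
  then show ?thesis
    by (simp add: mat_card_subspace subspace_transpose assms power_inject_exp[OF field_card_gt_1])
qed

lemma transpose_image_rowsp:
  fixes U :: "('a::field^'b) set"
  shows "transpose ` {M. rowsp M \<subseteq> U} = {M. colsp M \<subseteq> U}"
proof -
  have "M \<in> transpose ` {M. rowsp M \<subseteq> U}" if "colsp M \<subseteq> U" for M :: "'a^'c^'b"
    using that by (intro image_eqI[of _ _ "transpose M"]) (simp_all add: rowsp_transpose)
  then show ?thesis by (auto simp: colsp_transpose)
qed

lemma transpose_image_colsp: "transpose ` {M. colsp M \<subseteq> U} = {M. rowsp M \<subseteq> U}"
  unfolding transpose_image_rowsp[symmetric] by (simp add: image_image)

lemma dim_rowsp:
  fixes U :: "('a::{field,finite}^'m) set"
  assumes U: "vec.subspace U"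
  shows "mat.dim {M :: 'a^'m^'n. rowsp M \<subseteq> U} = CARD('n) * vec.dim U"
proof -
  let ?S = "{M :: 'a^'m^'n. rowsp M \<subseteq> U}"
  have "bij_betw vec_nth ?S (UNIV \<rightarrow>\<^sub>E U)"
    using U by (intro bij_betw_byWitness[where f' = vec_lambda]) (auto simp: rowsp_subset_iff PiE_def)
  then have "card ?S = card ((UNIV :: 'n set) \<rightarrow>\<^sub>E U)"
    by (rule bij_betw_same_card)
  then have "CARD('a) ^ mat.dim ?S = CARD('a) ^ (CARD('n) * vec.dim U)"
    by (simp add: card_PiE mat_card_subspace subspace_rowsp U vec_card_subspace mult.commute flip: power_mult)
  then show ?thesis
    using power_inject_exp[OF field_card_gt_1] by blast
qed

lemma dim_colsp:
  fixes U :: "('a::{field,finite}^'n) set"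
  assumes U: "vec.subspace U"
  shows "mat.dim {M :: 'a^'m^'n. colsp M \<subseteq> U} = CARD('m) * vec.dim U"
  unfolding transpose_image_rowsp[symmetric] dim_transpose[OF subspace_rowsp[OF U]]
  by (rule dim_rowsp[OF U])

text \<open>If w = E $ k were not a multiple of v = E $ i, then E has rank at least 2, so there is another
  pivot row j. Extend v (placed in row j) to independent pivot rows whose span misses w. Adding E
  to the corresponding code word preserves the span of the pivot rows, which contains row k both
  before and after; hence it contains the difference w.\<close>

lemma row_mem_span_pivot_row:
  fixes C :: "('a::field^'m^'n) set"
  assumes C: "mat.subspace C" and rank: "\<And>M. M \<in> C \<Longrightarrow> rank M \<le> card I"
    and nm: "CARD('n) \<le> CARD('m)"
    and inj: "\<And>M. M \<in> C \<Longrightarrow> (\<And>i. i \<in> I \<Longrightarrow> M $ i = 0) \<Longrightarrow> M = 0"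
    and surj: "\<And>x. \<exists>M\<in>C. \<forall>i\<in>I. M $ i = x i"
    and E: "E \<in> C" "i \<in> I" "\<And>a. a \<in> I \<Longrightarrow> a \<noteq> i \<Longrightarrow> E $ a = 0"
  shows "E $ k \<in> vec.span {E $ i}"
proof (rule ccontr)
  define v w where "v = E $ i" and "w = E $ k"
  assume "E $ k \<notin> vec.span {E $ i}"
  then have w: "w \<notin> vec.span {v}" by (simp add: v_def w_def)
  have "w \<noteq> 0" using w vec.span_zero by metis
  have k: "k \<notin> I"
    using w E \<open>w \<noteq> 0\<close> vec.span_base[of v "{v}"] by (metis singletonI v_def w_def)
  have "v \<noteq> 0"
    using inj[OF E(1)] E \<open>w \<noteq> 0\<close> by (metis v_def w_def zero_index)
  then have vw: "vec.dim {v, w} = 2"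
    using w by (subst insert_commute) (simp add: vec.dim_insert)
  have "vec.dim ((\<lambda>a. E $ a) ` {i, k}) \<le> card I"
    using dim_rows_le_rank rank[OF E(1)] by (rule order_trans)
  then have I2: "2 \<le> card I" using vw by (simp add: v_def w_def)
  have "\<not> I \<subseteq> {i}"
    using I2 card_mono[of "{i}" I] by auto
  then obtain j where j: "j \<in> I" "j \<noteq> i" by blast
  \<comment> \<open>Row \<open>k\<close> is not a pivot row, so there is room for \<open>w\<close>
    beside \<open>card I\<close> independent pivot rows.\<close>
  have "card (insert k I) \<le> CARD('n)" by (intro card_mono) auto
  then have "Suc (card I) \<le> CARD('m)" using k nm by simp
  then have "\<exists>x. (\<forall>i\<in>I - {j}. x i \<in> UNIV) \<and>
      vec.dim {v, w} + card (I - {j}) \<le> vec.dim ({v, w} \<union> x ` (I - {j}))"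
    using vw I2 j(1) by (intro exists_independent_choice) (auto simp: card_cart_basis)
  then obtain x where "vec.dim {v, w} + card (I - {j}) \<le> vec.dim ({v, w} \<union> x ` (I - {j}))"
    by blast
  then have x: "Suc (card I) \<le> vec.dim ({v, w} \<union> x ` (I - {j}))"
    using vw I2 j(1) by simp
  \<comment> \<open>Row \<open>i\<close> of \<open>E\<close> is \<open>v\<close>. With
    \<open>v\<close> also in row \<open>j\<close>, adding \<open>E\<close> to a word with pivot rows
    \<open>y\<close> amounts on these rows to adding row \<open>j\<close> to row \<open>i\<close>,
    which preserves their span.\<close>
  define y where "y = x(j := v)"
  have y: "{v, w} \<union> x ` (I - {j}) = insert w (y ` I)"
    using j(1) by (auto simp: y_def)
  have "vec.dim (y ` I) \<le> card I" 
    using dim_Un_image_le[OF finite[of I], of "{}" y] by simp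
  with x have yI: "vec.dim (y ` I) = card I" "w \<notin> vec.span (y ` I)"
    unfolding y by (auto simp: vec.dim_insert split: if_splits)
  \<comment> \<open>The pivot rows already reach the largest rank allowed, so row \<open>k\<close>
    cannot leave their span.\<close>
  have row_k: "N $ k \<in> vec.span (y ` I)"
    if "N \<in> C" "vec.span ((\<lambda>a. N $ a) ` I) = vec.span (y ` I)" for N
  proof -
    have "vec.dim ((\<lambda>a. N $ a) ` insert k I) \<le> card I"
      using dim_rows_le_rank rank[OF that(1)] by (rule order_trans)
    moreover have "vec.dim ((\<lambda>a. N $ a) ` I) = card I"
      using yI(1) that(2) by (metis vec.dim_span)
    ultimately show ?thesis
      using that(2) by (auto simp: vec.dim_insert split: if_splits)
  qed
  obtain M where M: "M \<in> C" "\<And>a. a \<in> I \<Longrightarrow> M $ a = y a" using surj[of y] by blast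
  have "M $ k \<in> vec.span (y ` I)"
    using M by (intro row_k) auto
  moreover have "(M + E) $ k \<in> vec.span (y ` I)"
  proof (rule row_k)
    show "M + E \<in> C" using M(1) E(1) by (rule mat.subspace_add[OF C])
    let ?N = "\<lambda>a. (M + E) $ a"
    have N: "?N a = y a" if "a \<in> I" "a \<noteq> i" for a using that M(2) E(3) by simp
    have Ni: "?N i = y i + y j" using M(2)[OF E(2)] by (simp add: y_def v_def)
    show "vec.span (?N ` I) = vec.span (y ` I)"
    proof (rule vec.span_eq[THEN iffD2], intro conjI image_subsetI)
      fix a assume a: "a \<in> I"
      show "?N a \<in> vec.span (y ` I)"
        using N[OF a] Ni a j(1) by (cases "a = i") (auto intro!: vec.span_add intro: vec.span_base)
      have "y i = ?N i - ?N j" using Ni N[OF j] by simp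
      then show "y a \<in> vec.span (?N ` I)"
        using N[OF a] a j(1) E(2) vec.span_diff[of "?N i" "?N ` I" "?N j"]
        by (cases "a = i") (metis vec.span_base imageI)+
    qed
  qed
  ultimately have "(M + E) $ k - M $ k \<in> vec.span (y ` I)"
    by (rule vec.span_diff[rotated])
  then show False using yI(2) by (simp add: w_def)
qed

text \<open>By counting, \<open>C\<close> projects bijectively onto the rows in \<open>I\<close>.
  The words above the matrix units consist of a vector \<open>u i\<close> in a single column, where
  \<open>u i\<close> does not depend on the column; \<open>U\<close> is the span of these
  vectors.\<close>

lemma code_eq_colsp_if_row_projection_inj:
  fixes C :: "('a::{field,finite}^'m^'n) set"
  assumes C: "mat.subspace C" and rank: "\<And>M. M \<in> C \<Longrightarrow> rank M \<le> t"
    and nm: "CARD('n) \<le> CARD('m)" and dim: "mat.dim C = t * CARD('m)"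
    and I: "card I \<le> t"
    and inj: "\<And>M. M \<in> C \<Longrightarrow> (\<And>i. i \<in> I \<Longrightarrow> M $ i = 0) \<Longrightarrow> M = 0"
  shows "\<exists>U. vec.subspace U \<and> C = {M. colsp M \<subseteq> U}"
proof -
  define \<phi> where "\<phi> = (\<lambda>M :: 'a^'m^'n. restrict (\<lambda>i. M $ i) I)"
  have "inj_on \<phi> C"
  proof (rule inj_onI)
    fix M N assume MN: "M \<in> C" "N \<in> C" "\<phi> M = \<phi> N"
    then have "(M - N) $ i = 0" if "i \<in> I" for i
      using that by (auto simp: \<phi>_def restrict_def fun_eq_iff) metis
    then have "M - N = 0" using MN mat.subspace_diff[OF C] by (intro inj) auto
    then show "M = N" by simp
  qed
  then have card_\<phi>: "card (\<phi> ` C) = CARD('a) ^ (t * CARD('m))"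
    by (simp add: card_image mat_card_subspace[OF C] dim)
  have sub: "\<phi> ` C \<subseteq> I \<rightarrow>\<^sub>E UNIV" by (auto simp: \<phi>_def)
  have "CARD('a^'m) = CARD('a) ^ CARD('m)"
    using vec_card_subspace[of "UNIV :: ('a^'m) set"] by (simp add: card_cart_basis)
  then have card_fun: "card (I \<rightarrow>\<^sub>E (UNIV :: ('a^'m) set)) = CARD('a) ^ (card I * CARD('m))"
    by (simp add: card_PiE mult.commute flip: power_mult)
  have fin: "finite (I \<rightarrow>\<^sub>E (UNIV :: ('a^'m) set))" by (intro finite_PiE) auto
  have "CARD('a) ^ (t * CARD('m)) \<le> CARD('a) ^ (card I * CARD('m))"
    using card_mono[OF fin sub] card_\<phi> card_fun by simp
  then have "t \<le> card I"
    using power_le_imp_le_exp[OF field_card_gt_1] by fastforce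
  with I have t: "card I = t" by simp
  then have \<phi>C: "\<phi> ` C = I \<rightarrow>\<^sub>E UNIV"
    using card_\<phi> card_fun by (intro card_subset_eq[OF fin sub]) simp
  have surj: "\<exists>M\<in>C. \<forall>i\<in>I. M $ i = x i" for x
  proof -
    have "restrict x I \<in> \<phi> ` C" unfolding \<phi>C by auto
    then obtain M where "M \<in> C" "restrict x I = \<phi> M" by blast
    then show ?thesis by (intro bexI[of _ M]) (auto simp: \<phi>_def restrict_def fun_eq_iff, metis)
  qed
  have span: "E $ k \<in> vec.span {E $ i}"
    if "E \<in> C" "i \<in> I" "\<And>a. a \<in> I \<Longrightarrow> a \<noteq> i \<Longrightarrow> E $ a = 0" for E i k
    using C rank[folded t] nm inj surj that by (rule row_mem_span_pivot_row)
  \<comment> \<open>The words \<open>E i j\<close> lift the matrix units on the pivot rows. By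
    \<open>span\<close>, all their rows are multiples of \<open>axis j 1\<close>.\<close>
  have "\<exists>M\<in>C. \<forall>a\<in>I. M $ a = (if a = i then axis j 1 else 0)" for i j
    by (rule surj)
  then obtain E where E: "E i j \<in> C" "\<And>a. a \<in> I \<Longrightarrow> E i j $ a = (if a = i then axis j 1 else 0)" for i j
    by metis
  have E0: "E i j $ k $ l = 0" if "i \<in> I" "l \<noteq> j" for i j k l
  proof -
    have "E i j $ k \<in> vec.span {axis j 1}"
      using span[OF E(1)[of i j] that(1), of k] E(2) that(1) by simp
    then show ?thesis using that(2) by (auto simp: vec.span_singleton axis_def)
  qed
  have Eq: "E i j $ k $ j = E i l $ k $ l" if "i \<in> I" for i j k l
  proof (cases "j = l")
    case False
    \<comment> \<open>The sum also has row \<open>i\<close> as its only nonzero pivot row, so its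
      rows are multiples of \<open>axis j 1 + axis l 1\<close>, with equal entries in columns
      \<open>j\<close> and \<open>l\<close>.\<close>
    have "(E i j + E i l) $ k \<in> vec.span {(E i j + E i l) $ i}"
      using that E by (intro span mat.subspace_add[OF C]) auto
    moreover have "(E i j + E i l) $ i = axis j 1 + axis l 1"
      using E(2) that by simp
    ultimately have "(E i j + E i l) $ k \<in> vec.span {axis j 1 + axis l 1}"
      by metis
    then obtain c where "(E i j + E i l) $ k = c *s (axis j 1 + axis l 1)"
      unfolding vec.span_singleton by blast
    then have c: "E i j $ k $ a + E i l $ k $ a = c * (axis j 1 $ a + axis l 1 $ a)" for a
      by (simp add: vec_eq_iff distrib_left)
    show ?thesis using c[of j] c[of l] False E0[OF that] by (simp add: axis_def)
  qed simp
  \<comment> \<open>By \<open>Eq\<close> every column yields the same vector;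
    \<open>undefined\<close> is just some column.\<close>
  define u where "u i = (\<chi> k. E i undefined $ k $ undefined)" for i
  have u: "E i j $ k $ l = (if l = j then u i $ k else 0)" if "i \<in> I" for i j k l
    using E0[OF that] Eq[OF that, of j k undefined] by (simp add: u_def)
  define U where "U = vec.span (u ` I)"
  have U: "vec.subspace U" by (simp add: U_def)
  have "colsp M \<subseteq> U" if "M \<in> C" for M
  proof -
    \<comment> \<open>\<open>N\<close> combines the lifted matrix units so as to have the same pivot
      rows as \<open>M\<close>; injectivity gives \<open>M = N\<close>.\<close>
    define N where "N = (\<Sum>i\<in>I. \<Sum>j\<in>UNIV. mscale (M $ i $ j) (E i j))"
    have N: "N $ k $ l = (\<Sum>i\<in>I. M $ i $ l * u i $ k)" for k l
    proof -
      have "N $ k $ l = (\<Sum>i\<in>I. \<Sum>j\<in>UNIV. M $ i $ j * E i j $ k $ l)"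
        by (simp add: N_def)
      also have "\<dots> = (\<Sum>i\<in>I. \<Sum>j\<in>UNIV. if j = l then M $ i $ l * u i $ k else 0)"
        by (intro sum.cong refl) (simp add: u)
      finally show ?thesis by simp
    qed
    have uI: "u i $ k = (if k = i then 1 else 0)" if "i \<in> I" "k \<in> I" for i k
      using u[OF that(1), of undefined k undefined] E(2)[OF that(2), of i undefined]
      by (auto simp: axis_def)
    have "M - N \<in> C"
      unfolding N_def using that E(1)
      by (intro mat.subspace_diff[OF C] mat.subspace_sum[OF C] mat.subspace_scale[OF C])
    moreover have "(M - N) $ k = 0" if "k \<in> I" for k
    proof -
      have "N $ k $ l = (\<Sum>i\<in>I. if k = i then M $ k $ l else 0)" for l
        unfolding N using that by (intro sum.cong refl) (simp add: uI)
      then show ?thesis using that by (simp add: vec_eq_iff)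
    qed
    ultimately have "M = N" using inj[of "M - N"] by simp
    have "column l M = (\<Sum>i\<in>I. M $ i $ l *s u i)" for l
      by (subst \<open>M = N\<close>) (simp add: vec_eq_iff column_def N)
    then show ?thesis
      unfolding colsp_subset_iff[OF U] unfolding U_def
      by (auto intro!: vec.span_sum vec.span_scale intro: vec.span_base)
  qed
  moreover have "M \<in> C" if "colsp M \<subseteq> U" for M
  proof -
    \<comment> \<open>\<open>out l y\<close> has \<open>y\<close> in column \<open>l\<close> and
      zeros elsewhere. As \<open>out l (u i)\<close> is \<open>E i l\<close>, linearity puts
      \<open>out l y\<close> into \<open>C\<close> for all \<open>y\<close> in
      \<open>U\<close>.\<close>
    define out :: "'m \<Rightarrow> 'a^'n \<Rightarrow> 'a^'m^'n"
      where "out l y = (\<chi> k l'. if l' = l then y $ k else 0)" for l y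
    have out: "out l y \<in> C" if "y \<in> U" for l y
    proof -
      have "vec.subspace {y. out l y \<in> C}"
      proof (rule vec.subspaceI)
        have "out l 0 = 0" by (simp add: out_def vec_eq_iff)
        then show "0 \<in> {y. out l y \<in> C}" using mat.subspace_0[OF C] by simp
      next
        fix x y assume "x \<in> {y. out l y \<in> C}" "y \<in> {y. out l y \<in> C}"
        moreover have "out l (x + y) = out l x + out l y" by (simp add: out_def vec_eq_iff)
        ultimately show "x + y \<in> {y. out l y \<in> C}" using mat.subspace_add[OF C] by simp
      next
        fix c x assume "x \<in> {y. out l y \<in> C}"
        moreover have "out l (c *s x) = mscale c (out l x)" by (simp add: out_def vec_eq_iff)
        ultimately show "c *s x \<in> {y. out l y \<in> C}" using mat.subspace_scale[OF C] by simp
      qed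
      moreover have "out l (u i) = E i l" if "i \<in> I" for i
        using u[OF that] by (simp add: out_def vec_eq_iff)
      ultimately have "y \<in> {y. out l y \<in> C}"
        using that E(1) unfolding U_def by (elim vec.span_subspace_induct) auto
      then show ?thesis by simp
    qed
    have "M = (\<Sum>l\<in>UNIV. out l (column l M))"
      by (simp add: vec_eq_iff out_def column_def)
    also have "\<dots> \<in> C"
      using that U by (intro mat.subspace_sum[OF C] out) (simp add: colsp_subset_iff)
    finally show ?thesis .
  qed
  ultimately show ?thesis using U by blast
qed

text \<open>A coordinate in which some vector of \<open>W\<close> is nonzero cuts out a proper
  subspace; continue there. The resulting \<open>J\<close> is an information set of
  \<open>W\<close>.\<close>

lemma exists_coordinates_separating:
  fixes W :: "('a::field^'m) set"
  assumes "vec.subspace W"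
  shows "\<exists>J. card J \<le> vec.dim W \<and> (\<forall>x\<in>W. (\<forall>j\<in>J. x $ j = 0) \<longrightarrow> x = 0)"
  using assms
proof (induction "vec.dim W" arbitrary: W rule: less_induct)
  case less
  show ?case
  proof (cases "W \<subseteq> {0}")
    case True
    then show ?thesis by (intro exI[of _ "{}"]) auto
  next
    case False
    then obtain x where "x \<in> W" "x \<noteq> 0" by blast
    then obtain j where x: "x \<in> W" "x $ j \<noteq> 0" by (auto simp: vec_eq_iff)
    define V where "V = W \<inter> {y. y $ j = 0}"
    have V: "vec.subspace V"
      unfolding V_def by (intro vec.subspace_inter less.prems) (auto intro: vec.subspaceI)
    have "V \<subset> W" using x by (auto simp: V_def)
    then have "vec.span V \<subset> vec.span W"
      using V less.prems vec.span_eq_iff by metis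
    then have lt: "vec.dim V < vec.dim W" by (rule vec.dim_psubset)
    from less.hyps[OF this V] obtain J
      where J: "card J \<le> vec.dim V" "\<forall>x\<in>V. (\<forall>j\<in>J. x $ j = 0) \<longrightarrow> x = 0" by blast
    have "card (insert j J) \<le> vec.dim W"
      using J(1) lt card_insert_le_m1[of "vec.dim W" J j] by simp
    moreover have "\<forall>x\<in>W. (\<forall>j\<in>insert j J. x $ j = 0) \<longrightarrow> x = 0"
      using J(2) by (auto simp: V_def)
    ultimately show ?thesis by blast
  qed
qed

text \<open>Take a nonzero row that is earliest with respect to \<open>e\<close>. This reduces the
  vanishing of a word to the leading spaces.\<close>

lemma exists_leading_row:
  fixes M :: "'a::field^'m^'n" and e :: "'n \<Rightarrow> nat"
  assumes "M \<in> C" "M \<noteq> 0"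
  obtains i where "M $ i \<noteq> 0" "M $ i \<in> leading e C i"
proof -
  obtain k where "M $ k \<noteq> 0" using assms(2) by (auto simp: vec_eq_iff)
  then obtain i where "M $ i \<noteq> 0" "\<And>k. M $ k \<noteq> 0 \<Longrightarrow> e i \<le> e k"
    using exists_least_iff[of "\<lambda>n. \<exists>i. M $ i \<noteq> 0 \<and> e i = n"] by (metis not_le)
  then show thesis
    using assms(1) by (intro that[of i]) (auto simp: leading_def not_le[symmetric])
qed

lemma max_dim_bounded_rank_code:
  fixes C :: "('a::{field,finite}^'m^'n) set"
  assumes C: "mat.subspace C" and rank: "\<And>M. M \<in> C \<Longrightarrow> rank M \<le> t"
    and nm: "CARD('n) \<le> CARD('m)" and dim: "mat.dim C = t * CARD('m)"
  shows "(\<exists>U. vec.subspace U \<and> C = {M. colsp M \<subseteq> U}) \<or>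
    (CARD('m) = CARD('n) \<and> (\<exists>U. vec.subspace U \<and> C = {M. rowsp M \<subseteq> U}))"
proof -
  obtain e :: "'n \<Rightarrow> nat" where e: "inj e"
    using finite_imp_inj_to_nat_seg[OF finite[of "UNIV :: 'n set"]] by auto
  \<comment> \<open>Such vectors give a code word with \<open>card I\<close> independent rows, whose
    rank is at most \<open>t\<close>.\<close>
  have le: "card I \<le> t" if p: "\<And>i. i \<in> I \<Longrightarrow> p i \<in> leading e C i" "card I \<le> vec.dim (p ` I)" for I p
  proof -
    have "\<exists>M\<in>C. vec.dim ({} :: ('a^'m) set) + card I \<le> vec.dim ({} \<union> (\<lambda>i. M $ i) ` I)"
    proof (rule exists_independent_rows[OF C e])
      show "\<exists>M\<in>C. M $ i = p i \<and> (\<forall>k. e k < e i \<longrightarrow> M $ k = 0)" if "i \<in> I" for i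
        using p(1)[OF that] by (auto simp: leading_def)
    qed (use p(2) in simp)
    then obtain M where "M \<in> C" "card I \<le> vec.dim ((\<lambda>i. M $ i) ` I)" by auto
    then show ?thesis
      using dim_rows_le_rank[of M I] rank[of M] by linarith
  qed
  have "t * CARD('m) \<le> (\<Sum>i\<in>UNIV. vec.dim (leading e C i))"
    using dim_le_sum_dim_leading[OF C] dim by metis
  with subspace_leading[OF C] le nm show ?thesis
  proof (rule subspaces_without_large_transversal)
    fix I assume I: "card I \<le> t" "\<And>i. i \<notin> I \<Longrightarrow> leading e C i = {0}"
    have "\<exists>U. vec.subspace U \<and> C = {M. colsp M \<subseteq> U}"
    proof (rule code_eq_colsp_if_row_projection_inj[OF C rank nm dim I(1)])
      fix M assume M: "M \<in> C" "\<And>i. i \<in> I \<Longrightarrow> M $ i = 0"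
      show "M = 0"
      proof (rule ccontr)
        assume "M \<noteq> 0"
        with M(1) obtain i where "M $ i \<noteq> 0" "M $ i \<in> leading e C i" by (rule exists_leading_row)
        then show False using I(2)[of i] M(2)[of i] by auto
      qed
    qed
    then show ?thesis by blast
  next
    fix W assume W: "CARD('n) = CARD('m)" "vec.dim W = t" "\<And>i. leading e C i = W"
    have "vec.subspace W" using subspace_leading[OF C] W(3) by metis
    then obtain J where J: "card J \<le> t" "\<forall>x\<in>W. (\<forall>j\<in>J. x $ j = 0) \<longrightarrow> x = 0"
      using exists_coordinates_separating W(2) by metis
    \<comment> \<open>A nonzero word has a nonzero row in \<open>W\<close>, so it cannot vanish in
      all columns of \<open>J\<close>. Hence the transposed code is determined by its rows in
      \<open>J\<close>, and \<open>m = n\<close> makes the row projection lemma applicable to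
      it.\<close>
    have "\<exists>U. vec.subspace U \<and> transpose ` C = {M. colsp M \<subseteq> U}"
    proof (rule code_eq_colsp_if_row_projection_inj[OF subspace_transpose[OF C] _ _ _ J(1)])
      show "rank M \<le> t" if "M \<in> transpose ` C" for M
        using that rank rank_transpose_le order_trans by blast
      show "CARD('m) \<le> CARD('n)" using W(1) by simp
      show "mat.dim (transpose ` C) = t * CARD('n)"
        using dim_transpose[OF C] dim W(1) by simp
      fix N assume "N \<in> transpose ` C" and N: "\<And>j. j \<in> J \<Longrightarrow> N $ j = 0"
      then obtain M where M: "M \<in> C" "N = transpose M" by blast
      have M0: "M $ i $ j = 0" if "j \<in> J" for i j
        using N[OF that] by (simp add: M(2) transpose_def vec_eq_iff)
      have "M = 0"
      proof (rule ccontr)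
        assume "M \<noteq> 0"
        with M(1) obtain i where "M $ i \<noteq> 0" "M $ i \<in> leading e C i" by (rule exists_leading_row)
        then show False using J(2) M0 W(3) by blast
      qed
      then show "N = 0" by (simp add: M(2) transpose_def vec_eq_iff)
    qed
    then obtain U where U: "vec.subspace U" "transpose ` C = {M. colsp M \<subseteq> U}" by blast
    have "C = transpose ` transpose ` C" by (simp add: image_image)
    then have "C = {M. rowsp M \<subseteq> U}" using U(2) transpose_image_colsp by metis
    with U(1) W(1) show ?thesis by auto
  qed
qed

subsection \<open>The rank functions\<close>

lemma subspace_perp: "vec.subspace (perp J)"
proof (rule vec.subspaceI)
  show "0 \<in> perp J" by (simp add: perp_def scalar_product_def)
next
  fix x y assume "x \<in> perp J" "y \<in> perp J"
  then show "x + y \<in> perp J"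
    by (simp add: perp_def scalar_product_def distrib_right sum.distrib)
next
  fix c x assume "x \<in> perp J"
  moreover have "scalar_product (c *s x) y = c * scalar_product x y" for y
    by (simp add: scalar_product_def sum_distrib_left mult.assoc)
  ultimately show "c *s x \<in> perp J" by (simp add: perp_def)
qed

lemma perp_antimono: "A \<subseteq> B \<Longrightarrow> perp B \<subseteq> perp A"
  by (auto simp: perp_def)

lemma scalar_product_commute:
  fixes x y :: "'a::field^'k"
  shows "scalar_product x y = scalar_product y x"
  by (simp add: scalar_product_def mult.commute)

lemma perp_span: "perp (vec.span S) = perp S"
proof
  show "perp (vec.span S) \<subseteq> perp S"
    by (intro perp_antimono vec.span_superset)
  show "perp S \<subseteq> perp (vec.span S)"
  proof
    fix x assume "x \<in> perp S"
    then have "S \<subseteq> perp {x}"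
      by (auto simp: perp_def scalar_product_commute)
    then have "vec.span S \<subseteq> perp {x}"
      by (rule vec.span_minimal[OF _ subspace_perp])
    then show "x \<in> perp (vec.span S)"
      by (auto simp: perp_def scalar_product_commute)
  qed
qed

lemma perp_Un: "perp (A \<union> B) = perp A \<inter> perp B"
  by (auto simp: perp_def)

lemma perp_UNIV: "perp (UNIV :: ('a::field^'k) set) = {0}"
proof -
  have "x = 0" if "x \<in> perp (UNIV :: ('a^'k) set)" for x
  proof -
    have "x $ i = scalar_product x (axis i 1)" for i
      by (simp add: scalar_product_def axis_def if_distrib cong: if_cong)
    then show ?thesis using that by (simp add: perp_def vec_eq_iff)
  qed
  then show ?thesis using vec.subspace_0[OF subspace_perp] by blast
qed

text \<open>\<open>perp {x}\<close> is a hyperplane or the whole space.\<close>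

lemma dim_le_Suc_dim_Int_perp:
  fixes U :: "('a::field^'k) set"
  assumes U: "vec.subspace U"
  shows "vec.dim U \<le> Suc (vec.dim (U \<inter> perp {x}))"
proof (cases "U \<subseteq> perp {x}")
  case True
  then show ?thesis by (simp add: Int_absorb2)
next
  case False
  then obtain y where y: "y \<in> U" "scalar_product y x \<noteq> 0" by (auto simp: perp_def)
  have "u \<in> vec.span (insert y (U \<inter> perp {x}))" if "u \<in> U" for u
  proof -
    define c where "c = scalar_product u x / scalar_product y x"
    have "scalar_product (u - c *s y) x = scalar_product u x - c * scalar_product y x"
      by (simp add: scalar_product_def left_diff_distrib sum_subtractf sum_distrib_left mult.assoc)
    then have "u - c *s y \<in> perp {x}" using y(2) by (simp add: perp_def c_def)
    then have "u - c *s y \<in> U \<inter> perp {x}"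
      using U that y(1) by (auto intro: vec.subspace_diff vec.subspace_scale)
    then have "(u - c *s y) + c *s y \<in> vec.span (insert y (U \<inter> perp {x}))"
      by (intro vec.span_add vec.span_scale) (auto intro: vec.span_base)
    then show ?thesis by simp
  qed
  then have "vec.dim U \<le> vec.dim (insert y (U \<inter> perp {x}))"
    by (metis subsetI vec.dim_mono)
  then show ?thesis by (simp add: vec.dim_insert split: if_splits)
qed

lemma dim_Int_perp_insert:
  fixes U :: "('a::field^'k) set"
  assumes "vec.subspace U"
  shows "vec.dim (U \<inter> perp S) \<le> Suc (vec.dim (U \<inter> perp (insert x S)))"
proof -
  have "U \<inter> perp (insert x S) = (U \<inter> perp S) \<inter> perp {x}"
    using perp_Un[of "{x}" S] by auto
  then show ?thesis
    using dim_le_Suc_dim_Int_perp[OF vec.subspace_inter[OF assms subspace_perp]] by metis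
qed

text \<open>Orthogonality to each vector of a basis of \<open>A\<close> costs at most one dimension,
  whence the bound by \<open>vec.dim A\<close>. Submodularity is the dimension formula for
  \<open>U \<inter> perp A\<close> and \<open>U \<inter> perp B\<close>, whose sum lies in
  \<open>perp (A \<inter> B)\<close>.\<close>

lemma q_matroid_if_dim_Int_perp:
  fixes U :: "('a::field^'k) set"
  assumes U: "vec.subspace U"
    and \<rho>: "\<And>J. \<rho> J = real (vec.dim U) - real (vec.dim (U \<inter> perp J))"
  shows "q_matroid \<rho>"
proof -
  have le_dim: "\<rho> A \<le> real (vec.dim A)" if "vec.subspace A" for A
  proof -
    obtain B where B: "B \<subseteq> A" "vec.independent B" "A \<subseteq> vec.span B" "card B = vec.dim A"
      by (rule vec.basis_exists)
    have "finite B" using B(2) by (rule vec.finiteI_independent)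
    then have "vec.dim U \<le> vec.dim (U \<inter> perp B) + card B"
    proof (induction B)
      case empty
      then show ?case by (simp add: perp_def)
    next
      case (insert x B)
      then show ?case using dim_Int_perp_insert[OF U, of B x] by simp
    qed
    moreover have "perp B = perp A"
      using vec.span_subspace[OF B(1,3) that] perp_span[of B] by simp
    ultimately show ?thesis using \<rho> B(4) by simp
  qed
  have nonneg: "0 \<le> \<rho> A" for A
    using vec.dim_subset[of "U \<inter> perp A" U] \<rho> by simp
  have mono: "\<rho> A \<le> \<rho> B" if "A \<subseteq> B" for A B
    using vec.dim_subset[of "U \<inter> perp B" "U \<inter> perp A"] perp_antimono[OF that] \<rho> by auto
  have submodular: "\<rho> (vec.span (A \<union> B)) + \<rho> (A \<inter> B) \<le> \<rho> A + \<rho> B" for A B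
  proof -
    let ?X = "U \<inter> perp A" and ?Y = "U \<inter> perp B"
    have X: "vec.subspace ?X" "vec.subspace ?Y" "vec.subspace (U \<inter> perp (A \<inter> B))"
      by (intro vec.subspace_inter U subspace_perp)+
    have "{x + y |x y. x \<in> ?X \<and> y \<in> ?Y} \<subseteq> U \<inter> perp (A \<inter> B)"
      using perp_antimono[of "A \<inter> B" A] perp_antimono[of "A \<inter> B" B] X(3)
      by (auto intro!: vec.subspace_add[OF U] vec.subspace_add[OF subspace_perp])
    then have "vec.dim {x + y |x y. x \<in> ?X \<and> y \<in> ?Y} \<le> vec.dim (U \<inter> perp (A \<inter> B))"
      by (rule vec.dim_subset)
    moreover have "U \<inter> perp (vec.span (A \<union> B)) = ?X \<inter> ?Y"
      by (auto simp: perp_span perp_Un)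
    ultimately show ?thesis
      using vec.dim_sums_Int[OF X(1,2)] \<rho> by simp
  qed
  have "\<rho> A \<in> \<int>" for A by (simp add: \<rho>)
  then show ?thesis
    unfolding q_matroid_def q_polymatroid_def
    by (simp add: le_dim nonneg mono submodular)
qed

text \<open>No value is skipped, since adding one vector to J changes \<rho> by at most 1.\<close>

lemma values_if_dim_Int_perp:
  fixes U :: "('a::{field,finite}^'k) set"
  assumes U: "vec.subspace U"
    and \<rho>: "\<And>J. \<rho> J = real (vec.dim U) - real (vec.dim (U \<inter> perp J))"
  shows "{\<rho> J | J. vec.subspace J} = real ` {0..vec.dim U}"
proof -
  \<comment> \<open>\<open>g\<close> is \<rho> as a natural number; evaluating it on arbitrary sets
    allows vectors to be added one by one.\<close>
  define g where "g S = vec.dim U - vec.dim (U \<inter> perp S)" for S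
  have \<rho>g: "\<rho> J = real (g J)" for J
    using vec.dim_subset[of "U \<inter> perp J" U] by (simp add: \<rho> g_def of_nat_diff)
  have "\<exists>J. vec.subspace J \<and> g J = k" if "finite S" "k \<le> g S" for S k
    using that
  proof (induction S arbitrary: k)
    case empty
    then have "k = 0" by (simp add: g_def perp_def)
    moreover have "g {0} = 0" by (simp add: g_def perp_def scalar_product_def)
    ultimately show ?case using vec.subspace_single_0 by blast
  next
    case (insert x S)
    have "g (insert x S) \<le> Suc (g S)"
      using dim_Int_perp_insert[OF U, of S x] by (simp add: g_def)
    \<comment> \<open>A \<open>k\<close> above \<open>g S\<close> must be the new value itself,
      which the span attains too.\<close>
    then consider "k \<le> g S" | "k = g (insert x S)" using insert.prems by linarith
    then show ?case
    proof cases
      case 1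
      then show ?thesis by (rule insert.IH)
    next
      case 2
      have "g (vec.span (insert x S)) = k" by (simp add: g_def perp_span 2)
      then show ?thesis using vec.subspace_span by blast
    qed
  qed
  moreover have "g UNIV = vec.dim U"
    using vec.subspace_0[OF U] by (simp add: g_def perp_UNIV)
  ultimately have "\<exists>J. vec.subspace J \<and> g J = k" if "k \<le> vec.dim U" for k
    using that finite[of "UNIV :: ('a^'k) set"] by metis
  moreover have "g J \<le> vec.dim U" for J by (simp add: g_def)
  ultimately show ?thesis by (fastforce simp: \<rho>g)
qed

section \<open>Rank functions of a code, in general and for prescribed supports\<close>

lemma subcode_c_perp_UNIV:
  assumes "mat.subspace C"
  shows "subcode_c C (perp UNIV) = {0}"
  unfolding subcode_c_def colsp_subset_iff[OF subspace_perp] unfolding perp_UNIV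
  using mat.subspace_0[OF assms] by (auto simp: column_def vec_eq_iff)

lemma subcode_r_perp_UNIV:
  assumes "mat.subspace C"
  shows "subcode_r C (perp UNIV) = {0}"
  unfolding subcode_r_def rowsp_subset_iff[OF subspace_perp] unfolding perp_UNIV
  using mat.subspace_0[OF assms] by (auto simp: vec_eq_iff)

lemma mat_dim_0: "mat.dim {0} = 0"
  using mat.dim_span[of "{}"] by (simp add: mat.dim_eq_card_independent[OF mat.independent_empty])

lemma rho_c_UNIV:
  fixes C :: "('a::field^'m^'n) set"
  assumes "mat.subspace C"
  shows "rho_c C UNIV = real (mat.dim C) / real CARD('m)"
  by (simp add: rho_c_def subcode_c_perp_UNIV[OF assms] mat_dim_0)

lemma rho_r_UNIV:
  fixes C :: "('a::field^'m^'n) set"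
  assumes "mat.subspace C"
  shows "rho_r C UNIV = real (mat.dim C) / real CARD('n)"
  by (simp add: rho_r_def subcode_r_perp_UNIV[OF assms] mat_dim_0)

text \<open>Subcodes of a code with column support \<open>U\<close> are again of this kind, with
  support \<open>U \<inter> perp J\<close>; the factor \<open>CARD('m)\<close> cancels.\<close>

lemma rho_c_colsp:
  fixes U :: "('a::{field,finite}^'n) set"
  assumes "vec.subspace U"
  shows "rho_c {M :: 'a^'m^'n. colsp M \<subseteq> U} J = real (vec.dim U) - real (vec.dim (U \<inter> perp J))"
proof -
  have "subcode_c {M :: 'a^'m^'n. colsp M \<subseteq> U} (perp J) = {M. colsp M \<subseteq> U \<inter> perp J}"
    by (auto simp: subcode_c_def)
  then have "mat.dim (subcode_c {M :: 'a^'m^'n. colsp M \<subseteq> U} (perp J)) = CARD('m) * vec.dim (U \<inter> perp J)"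
    by (simp only: dim_colsp[OF vec.subspace_inter[OF assms subspace_perp]])
  then show ?thesis
    by (simp add: rho_c_def dim_colsp[OF assms] diff_divide_distrib)
qed

lemma rho_r_rowsp:
  fixes U :: "('a::{field,finite}^'m) set"
  assumes "vec.subspace U"
  shows "rho_r {M :: 'a^'m^'n. rowsp M \<subseteq> U} J = real (vec.dim U) - real (vec.dim (U \<inter> perp J))"
proof -
  have "subcode_r {M :: 'a^'m^'n. rowsp M \<subseteq> U} (perp J) = {M. rowsp M \<subseteq> U \<inter> perp J}"
    by (auto simp: subcode_r_def)
  then have "mat.dim (subcode_r {M :: 'a^'m^'n. rowsp M \<subseteq> U} (perp J)) = CARD('n) * vec.dim (U \<inter> perp J)"
    by (simp only: dim_rowsp[OF vec.subspace_inter[OF assms subspace_perp]])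
  then show ?thesis
    by (simp add: rho_r_def dim_rowsp[OF assms] diff_divide_distrib)
qed

lemma top_value_eq:
  fixes \<rho> :: "('a::field^'k) set \<Rightarrow> real"
  assumes "{\<rho> J | J. vec.subspace J} = real ` {0..t}" and "\<And>J. \<rho> J \<le> \<rho> UNIV"
  shows "\<rho> UNIV = real t"
proof -
  have "\<rho> UNIV \<in> real ` {0..t}" using assms(1) vec.subspace_UNIV by blast
  moreover have "real t \<in> {\<rho> J | J. vec.subspace J}" unfolding assms(1) by auto
  then have "real t \<le> \<rho> UNIV" using assms(2) by auto
  ultimately show ?thesis by auto
qed

section \<open>Equivalence of the three conditions and the q-matroid property\<close>

theorem theorem6p2:
  fixes C :: "('a::{field,finite}^'m^'n) set"
  assumes "2 \<le> CARD('n)" and "CARD('n) \<le> CARD('m)"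
    and code: "mat.subspace C"
  defines "t \<equiv> maxrk C"
  shows "(optimal_anticode C \<longleftrightarrow>
            ({rho_c C J | J. vec.subspace J} = real ` {0..t} \<or>
             (CARD('m) = CARD('n) \<and> {rho_r C J | J. vec.subspace J} = real ` {0..t})))
       \<and> (({rho_c C J | J. vec.subspace J} = real ` {0..t} \<or>
             (CARD('m) = CARD('n) \<and> {rho_r C J | J. vec.subspace J} = real ` {0..t}))
          \<longleftrightarrow> (rho_c C UNIV = real t \<or> (CARD('m) = CARD('n) \<and> rho_r C UNIV = real t)))
       \<and> (optimal_anticode C \<longrightarrow>
            q_matroid (rho_c C) \<or> (CARD('m) = CARD('n) \<and> q_matroid (rho_r C)))"
proof -
  let ?values = "{rho_c C J | J. vec.subspace J} = real ` {0..t} \<or>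
    (CARD('m) = CARD('n) \<and> {rho_r C J | J. vec.subspace J} = real ` {0..t})"
  let ?top = "rho_c C UNIV = real t \<or> (CARD('m) = CARD('n) \<and> rho_r C UNIV = real t)"
  \<comment> \<open>On the whole space the rank functions are \<open>mat.dim C\<close> divided by
    \<open>CARD('m)\<close> or \<open>CARD('n)\<close>, so condition (3) unfolds to the definition
    of an optimal anticode.\<close>
  have top_iff: "?top \<longleftrightarrow> optimal_anticode C"
  proof -
    have "rho_c C UNIV = real t \<longleftrightarrow> real (mat.dim C) = real (CARD('m) * t)"
      by (simp add: rho_c_UNIV[OF code] divide_eq_eq mult.commute)
    moreover have "rho_r C UNIV = rho_c C UNIV" if "CARD('m) = CARD('n)"
      by (simp add: rho_c_UNIV[OF code] rho_r_UNIV[OF code] that)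
    ultimately show ?thesis
      unfolding optimal_anticode_def t_def of_nat_eq_iff by auto
  qed
  \<comment> \<open>Both rank functions are largest on the whole space, where no dimension is
    subtracted; so the largest listed value \<open>t\<close> occurs there.\<close>
  have top: ?top if ?values
  proof -
    have "rho_c C J \<le> rho_c C UNIV" for J
      unfolding rho_c_UNIV[OF code] unfolding rho_c_def by (intro divide_right_mono) auto
    moreover have "rho_r C J \<le> rho_r C UNIV" for J
      unfolding rho_r_UNIV[OF code] unfolding rho_r_def by (intro divide_right_mono) auto
    ultimately show ?thesis
      using that top_value_eq[of "rho_c C" t] top_value_eq[of "rho_r C" t] by blast
  qed
  have anticode: "?values \<and> (q_matroid (rho_c C) \<or> (CARD('m) = CARD('n) \<and> q_matroid (rho_r C)))"
    if "optimal_anticode C"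
  proof -
    have dim: "mat.dim C = t * CARD('m)"
      using that by (simp add: optimal_anticode_def t_def mult.commute)
    have "rank M \<le> t" if "M \<in> C" for M
      unfolding t_def maxrk_def using that by (intro Max_ge) auto
    \<comment> \<open>Column support makes \<open>rho_c\<close> the rank function attached to
      \<open>U\<close>, row support does so for \<open>rho_r\<close>. Comparing dimensions gives
      \<open>vec.dim U = t\<close>.\<close>
    from max_dim_bounded_rank_code[OF code this assms(2) dim] consider
      U where "vec.subspace U" "C = {M. colsp M \<subseteq> U}"
      | U where "CARD('m) = CARD('n)" "vec.subspace U" "C = {M. rowsp M \<subseteq> U}"
      by blast
    then show ?thesis
    proof cases
      case 1
      have "vec.dim U = t"
        using dim unfolding 1(2) dim_colsp[OF 1(1)] by simp
      moreover have "rho_c C J = real (vec.dim U) - real (vec.dim (U \<inter> perp J))" for J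
        unfolding 1(2) by (rule rho_c_colsp[OF 1(1)])
      ultimately show ?thesis
        using q_matroid_if_dim_Int_perp[OF 1(1), of "rho_c C"]
          values_if_dim_Int_perp[OF 1(1), of "rho_c C"] by metis
    next
      case 2
      have "vec.dim U = t"
        using dim 2(1) unfolding 2(3) dim_rowsp[OF 2(2)] by simp
      moreover have "rho_r C J = real (vec.dim U) - real (vec.dim (U \<inter> perp J))" for J
        unfolding 2(3) by (rule rho_r_rowsp[OF 2(2)])
      ultimately show ?thesis
        using q_matroid_if_dim_Int_perp[OF 2(2), of "rho_r C"] 2(1)
          values_if_dim_Int_perp[OF 2(2), of "rho_r C"] by metis
    qed
  qed
  \<comment> \<open>The cycle closes: \<open>?values\<close> gives \<open>?top\<close>, which is
    optimality, which gives \<open>?values\<close>.\<close>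
  show ?thesis using top_iff top anticode by argo
qed

end
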